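(* Let $\vec S$ be a nested separation system that is the inverse limit of an inverse system $(\vec S_p\mid p\in P)$ of finite separation systems. If all small separations in $\vec S$ are trivial, then $\vec S$ is normal. In particular, regular profinite tree sets are normal.
   Context: A separation system is a poset with an order-reversing involution $\vec s\mapsto\overleftarrow s$; $s=\{\vec s,\overleftarrow s\}$. $\vec s$ is small if $\vec s\le\overleftarrow s$, degenerate if $\vec s=\overleftarrow s$, trivial if there is $s'\ne s$ with $\vec s<\vec s'$ and $\vec s<\overleftarrow{s'}$. Nested: every two separations have comparable orientations. Regular: no small elements. Tree set: nested, without degenerate or trivial elements. Profinite: isomorphic to an inverse limit of finite separation systems. An orientation contains exactly one orientation of each separation; consistent: contains no $\overleftarrow r,\vec s$ with $r\ne s$, $\vec r<\vec s$. A consistent orientation $O$ splits if $O$ lies in the down-closure of its set of maximal elements. The inverse limit (over a directed poset $P$, with compatible homomorphisms $f_{qp}$ commuting with involutions and preserving $\le$) consists of compatible families, with componentwise order and involution, and carries the subspace topology of the product of the discrete $\vec S_p$. A nested $\vec S$ is normal if its consistent orientations that split are exactly those closed in $\vec S$. *)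

theory Defs
  imports "HOL-Analysis.Analysis"
begin

record 'a sepsys =
  carr :: "'a set"
  sle :: "'a rel"
  sinv :: "'a \<Rightarrow> 'a"

definition separation_system :: "'a sepsys \<Rightarrow> bool" where
  "separation_system S \<longleftrightarrow>
     partial_order_on (carr S) (sle S) \<and>
     (\<forall>s\<in>carr S. sinv S s \<in> carr S \<and> sinv S (sinv S s) = s) \<and>
     (\<forall>r s. (r, s) \<in> sle S \<longrightarrow> (sinv S s, sinv S r) \<in> sle S)"

definition sless :: "'a sepsys \<Rightarrow> 'a \<Rightarrow> 'a \<Rightarrow> bool" where
  "sless S r s \<longleftrightarrow> (r, s) \<in> sle S \<and> r \<noteq> s"

text \<open>The unoriented separation underlying an oriented one, as the set of its orientations.\<close>

definition unor :: "'a sepsys \<Rightarrow> 'a \<Rightarrow> 'a set" where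
  "unor S s = {s, sinv S s}"

definition small :: "'a sepsys \<Rightarrow> 'a \<Rightarrow> bool" where
  "small S s \<longleftrightarrow> (s, sinv S s) \<in> sle S"

definition degenerate :: "'a sepsys \<Rightarrow> 'a \<Rightarrow> bool" where
  "degenerate S s \<longleftrightarrow> s = sinv S s"

definition trivial :: "'a sepsys \<Rightarrow> 'a \<Rightarrow> bool" where
  "trivial S s \<longleftrightarrow>
     (\<exists>s'\<in>carr S. unor S s' \<noteq> unor S s \<and> sless S s s' \<and> sless S s (sinv S s'))"

definition nested :: "'a sepsys \<Rightarrow> bool" where
  "nested S \<longleftrightarrow>
     (\<forall>r\<in>carr S. \<forall>s\<in>carr S. \<exists>r'\<in>unor S r. \<exists>s'\<in>unor S s.
        (r', s') \<in> sle S \<or> (s', r') \<in> sle S)"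

definition regular :: "'a sepsys \<Rightarrow> bool" where
  "regular S \<longleftrightarrow> (\<forall>s\<in>carr S. \<not> small S s)"

definition tree_set :: "'a sepsys \<Rightarrow> bool" where
  "tree_set S \<longleftrightarrow>
     separation_system S \<and> nested S \<and> (\<forall>s\<in>carr S. \<not> degenerate S s \<and> \<not> trivial S s)"

definition orientation :: "'a sepsys \<Rightarrow> 'a set \<Rightarrow> bool" where
  "orientation S Q \<longleftrightarrow> Q \<subseteq> carr S \<and> (\<forall>s\<in>carr S. \<exists>!x. x \<in> Q \<and> x \<in> unor S s)"

definition consistent :: "'a sepsys \<Rightarrow> 'a set \<Rightarrow> bool" where
  "consistent S Q \<longleftrightarrow>
     \<not> (\<exists>r\<in>carr S. \<exists>s\<in>carr S.
          unor S r \<noteq> unor S s \<and> sless S r s \<and> sinv S r \<in> Q \<and> s \<in> Q)"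

definition maximal_elements :: "'a sepsys \<Rightarrow> 'a set \<Rightarrow> 'a set" where
  "maximal_elements S Q = {m \<in> Q. \<not> (\<exists>x\<in>Q. sless S m x)}"

definition down_closure :: "'a sepsys \<Rightarrow> 'a set \<Rightarrow> 'a set" where
  "down_closure S Q = {x \<in> carr S. \<exists>y\<in>Q. (x, y) \<in> sle S}"

definition splits :: "'a sepsys \<Rightarrow> 'a set \<Rightarrow> bool" where
  "splits S Q \<longleftrightarrow> Q \<subseteq> down_closure S (maximal_elements S Q)"

definition sep_hom :: "'a sepsys \<Rightarrow> 'b sepsys \<Rightarrow> ('a \<Rightarrow> 'b) \<Rightarrow> bool" where
  "sep_hom S T h \<longleftrightarrow>
     h ` carr S \<subseteq> carr T \<and>
     (\<forall>s\<in>carr S. h (sinv S s) = sinv T (h s)) \<and>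
     (\<forall>r s. (r, s) \<in> sle S \<longrightarrow> (h r, h s) \<in> sle T)"

definition sep_iso :: "'a sepsys \<Rightarrow> 'b sepsys \<Rightarrow> ('a \<Rightarrow> 'b) \<Rightarrow> bool" where
  "sep_iso S T h \<longleftrightarrow>
     bij_betw h (carr S) (carr T) \<and>
     sep_hom S T h \<and> sep_hom T S (inv_into (carr S) h)"

definition directed_poset :: "'i set \<Rightarrow> 'i rel \<Rightarrow> bool" where
  "directed_poset P R \<longleftrightarrow>
     P \<noteq> {} \<and> partial_order_on P R \<and>
     (\<forall>p\<in>P. \<forall>q\<in>P. \<exists>r\<in>P. (p, r) \<in> R \<and> (q, r) \<in> R)"

text \<open>
  The bonding map \<open>f q p\<close> goes from \<open>S q\<close> to \<open>S p\<close>, for \<open>p < q\<close>; values of \<open>f q p\<close> for other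
  pairs \<open>p, q\<close> are irrelevant. All \<open>S p\<close> live on one type, which is no restriction, as any family of
  separation systems can be copied into a disjoint union.
\<close>

definition inverse_system ::
  "'i set \<Rightarrow> 'i rel \<Rightarrow> ('i \<Rightarrow> 'a sepsys) \<Rightarrow> ('i \<Rightarrow> 'i \<Rightarrow> 'a \<Rightarrow> 'a) \<Rightarrow> bool" where
  "inverse_system P R S f \<longleftrightarrow>
     directed_poset P R \<and>
     (\<forall>p\<in>P. separation_system (S p)) \<and>
     (\<forall>p q. (p, q) \<in> R \<and> p \<noteq> q \<longrightarrow> sep_hom (S q) (S p) (f q p)) \<and>
     (\<forall>p q r. (p, q) \<in> R \<and> p \<noteq> q \<and> (q, r) \<in> R \<and> q \<noteq> r \<longrightarrow>
        (\<forall>x\<in>carr (S r). f r p x = f q p (f r q x)))"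

definition inverse_limit ::
  "'i set \<Rightarrow> 'i rel \<Rightarrow> ('i \<Rightarrow> 'a sepsys) \<Rightarrow> ('i \<Rightarrow> 'i \<Rightarrow> 'a \<Rightarrow> 'a) \<Rightarrow> ('i \<Rightarrow> 'a) sepsys" where
  "inverse_limit P R S f =
     (let L = {x \<in> (\<Pi>\<^sub>E p\<in>P. carr (S p)). \<forall>p q. (p, q) \<in> R \<and> p \<noteq> q \<longrightarrow> f q p (x q) = x p} in
      \<lparr> carr = L,
        sle = {(x, y). x \<in> L \<and> y \<in> L \<and> (\<forall>p\<in>P. (x p, y p) \<in> sle (S p))},
        sinv = (\<lambda>x. \<lambda>p\<in>P. sinv (S p) (x p)) \<rparr>)"

definition inverse_limit_topology ::
  "'i set \<Rightarrow> 'i rel \<Rightarrow> ('i \<Rightarrow> 'a sepsys) \<Rightarrow> ('i \<Rightarrow> 'i \<Rightarrow> 'a \<Rightarrow> 'a) \<Rightarrow> ('i \<Rightarrow> 'a) topology" where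
  "inverse_limit_topology P R S f =
     subtopology (product_topology (\<lambda>p. discrete_topology (carr (S p))) P)
       (carr (inverse_limit P R S f))"

text \<open>
  \<open>profinite_via S X P R F f h\<close>: the separation system \<open>S\<close> is profinite, as witnessed by the
  isomorphism \<open>h\<close> onto the inverse limit of the finite separation systems \<open>F p\<close>, and \<open>X\<close> is the
  topology that \<open>S\<close> acquires from this limit through \<open>h\<close>. The witness is explicit because
  the topology of a profinite separation system depends on it.
\<close>

definition profinite_via ::
  "'b sepsys \<Rightarrow> 'b topology \<Rightarrow> 'i set \<Rightarrow> 'i rel \<Rightarrow> ('i \<Rightarrow> 'a sepsys) \<Rightarrow> ('i \<Rightarrow> 'i \<Rightarrow> 'a \<Rightarrow> 'a)
     \<Rightarrow> ('b \<Rightarrow> 'i \<Rightarrow> 'a) \<Rightarrow> bool" where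
  "profinite_via S X P R F f h \<longleftrightarrow>
     separation_system S \<and>
     inverse_system P R F f \<and> (\<forall>p\<in>P. finite (carr (F p))) \<and>
     sep_iso S (inverse_limit P R F f) h \<and>
     X = pullback_topology (carr S) h (inverse_limit_topology P R F f)"

definition normal :: "'a sepsys \<Rightarrow> 'a topology \<Rightarrow> bool" where
  "normal S X \<longleftrightarrow>
     nested S \<and>
     {Q. orientation S Q \<and> consistent S Q \<and> splits S Q} =
     {Q. orientation S Q \<and> consistent S Q \<and> closedin X Q}"

lemma separation_system_inverse_limit:
  assumes "inverse_system P R S f"
  shows "separation_system (inverse_limit P R S f)"
proof -
  have sep: "separation_system (S p)" if "p \<in> P" for p
    using assms that by (simp add: inverse_system_def)
  have R: "R \<subseteq> P \<times> P"
    using assms by (auto simp: inverse_system_def directed_poset_def dest: partial_order_onD(4))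
  have hom: "sep_hom (S q) (S p) (f q p)" if "(p, q) \<in> R" "p \<noteq> q" for p q
    using assms that by (simp add: inverse_system_def)
  let ?L = "inverse_limit P R S f"
  have carr: "x \<in> carr ?L \<longleftrightarrow> x \<in> (\<Pi>\<^sub>E p\<in>P. carr (S p)) \<and>
      (\<forall>p q. (p, q) \<in> R \<and> p \<noteq> q \<longrightarrow> f q p (x q) = x p)" for x
    by (simp add: inverse_limit_def Let_def)
  have le: "(x, y) \<in> sle ?L \<longleftrightarrow> x \<in> carr ?L \<and> y \<in> carr ?L \<and> (\<forall>p\<in>P. (x p, y p) \<in> sle (S p))" for x y
    by (simp add: inverse_limit_def Let_def)
  have inv: "sinv ?L x = (\<lambda>p\<in>P. sinv (S p) (x p))" for x
    by (simp add: inverse_limit_def Let_def)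
  have mem: "x p \<in> carr (S p)" if "x \<in> carr ?L" "p \<in> P" for x p
    using that by (auto simp: carr)
  have invc: "sinv ?L x \<in> carr ?L" if x: "x \<in> carr ?L" for x
    unfolding carr
  proof (intro conjI allI impI)
    show "sinv ?L x \<in> (\<Pi>\<^sub>E p\<in>P. carr (S p))"
      using mem[OF x] sep by (auto simp: inv separation_system_def)
    fix p q assume pq: "(p, q) \<in> R \<and> p \<noteq> q"
    then have "p \<in> P" "q \<in> P" using R by auto
    then show "f q p (sinv ?L x q) = sinv ?L x p"
      using hom[of p q] pq mem[OF x] x by (auto simp: inv sep_hom_def carr)
  qed
  have inv2: "sinv ?L (sinv ?L x) = x" if x: "x \<in> carr ?L" for x
  proof
    fix p show "sinv ?L (sinv ?L x) p = x p"
    proof (cases "p \<in> P")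
      case True
      with mem[OF x True] sep[OF True] show ?thesis by (simp add: inv separation_system_def)
    next
      case False
      have "x \<in> (\<Pi>\<^sub>E p\<in>P. carr (S p))" using x carr by blast
      from PiE_arb[OF this False] False show ?thesis by (simp add: inv)
    qed
  qed
  have "refl_on (carr ?L) (sle ?L)"
    using mem sep by (auto simp: refl_on_def le separation_system_def
        partial_order_on_def preorder_on_def)
  moreover have "trans (sle ?L)"
  proof (rule transI)
    fix x y z assume a: "(x, y) \<in> sle ?L" "(y, z) \<in> sle ?L"
    have "(x p, z p) \<in> sle (S p)" if "p \<in> P" for p
    proof -
      have "trans (sle (S p))" "(x p, y p) \<in> sle (S p)" "(y p, z p) \<in> sle (S p)"
        using a that sep[OF that] partial_order_onD(2) unfolding le separation_system_def by blast+
      then show ?thesis by (rule transD)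
    qed
    then show "(x, z) \<in> sle ?L" using a by (simp add: le)
  qed
  moreover have "antisym (sle ?L)"
  proof (rule antisymI)
    fix x y assume a: "(x, y) \<in> sle ?L" "(y, x) \<in> sle ?L"
    have "x p = y p" if "p \<in> P" for p
    proof -
      have "antisym (sle (S p))" "(x p, y p) \<in> sle (S p)" "(y p, x p) \<in> sle (S p)"
        using a that sep[OF that] partial_order_onD(3) unfolding le separation_system_def by blast+
      then show ?thesis by (rule antisymD)
    qed
    moreover have "x \<in> (\<Pi>\<^sub>E p\<in>P. carr (S p))" "y \<in> (\<Pi>\<^sub>E p\<in>P. carr (S p))"
      using a by (auto simp: le carr)
    ultimately show "x = y" by (metis PiE_ext)
  qed
  moreover have "sle ?L \<subseteq> carr ?L \<times> carr ?L" by (auto simp: le)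
  moreover have "(sinv ?L y, sinv ?L x) \<in> sle ?L" if "(x, y) \<in> sle ?L" for x y
  proof -
    have "x \<in> carr ?L" "y \<in> carr ?L" using that le by auto
    then have "sinv ?L x \<in> carr ?L" "sinv ?L y \<in> carr ?L" using invc by auto
    moreover have "(sinv ?L y p, sinv ?L x p) \<in> sle (S p)" if p: "p \<in> P" for p
    proof -
      have "(x p, y p) \<in> sle (S p)" using \<open>(x, y) \<in> sle ?L\<close> p le by auto
      then show ?thesis using sep[OF p] p by (simp add: inv separation_system_def)
    qed
    ultimately show ?thesis using le by auto
  qed
  ultimately show ?thesis
    using invc inv2 by (simp add: separation_system_def partial_order_on_def preorder_on_def)
qed

end

theory Submission
  imports Defs
begin

text \<open>
  Closed implies split, by Zorn's lemma: principal up-sets are closed, so by compactness every chain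
  in a closed set has an upper bound in it.

  For the converse let \<open>Q\<close> be consistent and split, suppose that \<open>s\<close> lies in the closure
  of \<open>Q\<close> but not in \<open>Q\<close>, and let \<open>m\<close> be a maximal element of \<open>Q\<close> above the inverse of \<open>s\<close>. By
  nestedness and consistency every element of \<open>Q\<close> lies below \<open>m\<close> or below its inverse \<open>m'\<close>; this
  passes to the limit \<open>s\<close> and forces \<open>s = m'\<close>, since no element of \<open>Q\<close> has a small inverse. Close
  to \<open>m'\<close> there are elements of \<open>Q\<close>, hence either an element of \<open>Q\<close> below both \<open>m\<close> and \<open>m'\<close>, or
  two maximal elements \<open>a \<noteq> b\<close> of \<open>Q\<close>. In the latter case \<open>b\<close> lies below the inverse of \<open>a\<close>,
  which is close to \<open>m\<close>. Either way every projection of \<open>m'\<close> is small, so \<open>m'\<close> is small,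
  a contradiction.
\<close>

section \<open>Separation systems and their consistent orientations\<close>

lemma separation_systemD:
  assumes "separation_system S"
  shows "x \<in> carr S \<Longrightarrow> (x, x) \<in> sle S"
    and "(x, y) \<in> sle S \<Longrightarrow> (y, z) \<in> sle S \<Longrightarrow> (x, z) \<in> sle S"
    and "(x, y) \<in> sle S \<Longrightarrow> (y, x) \<in> sle S \<Longrightarrow> x = y"
    and "(x, y) \<in> sle S \<Longrightarrow> x \<in> carr S"
    and "(x, y) \<in> sle S \<Longrightarrow> y \<in> carr S"
    and "x \<in> carr S \<Longrightarrow> sinv S x \<in> carr S"
    and "x \<in> carr S \<Longrightarrow> sinv S (sinv S x) = x"
    and "(x, y) \<in> sle S \<Longrightarrow> (sinv S y, sinv S x) \<in> sle S"
proof -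
  have po: "partial_order_on (carr S) (sle S)"
    using assms by (simp add: separation_system_def)
  note po = partial_order_onD[OF po]
  show "x \<in> carr S \<Longrightarrow> (x, x) \<in> sle S" using po(1) by (rule refl_onD)
  show "(x, y) \<in> sle S \<Longrightarrow> (y, z) \<in> sle S \<Longrightarrow> (x, z) \<in> sle S" using po(2) by (rule transD)
  show "(x, y) \<in> sle S \<Longrightarrow> (y, x) \<in> sle S \<Longrightarrow> x = y" using po(3) by (rule antisymD)
  show "(x, y) \<in> sle S \<Longrightarrow> x \<in> carr S" "(x, y) \<in> sle S \<Longrightarrow> y \<in> carr S" using po(4) by auto
qed (use assms in \<open>auto simp: separation_system_def\<close>)

text \<open>The involution pairs up the eight possible comparisons, so four cases about
  \<open>r\<close> itself remain.\<close>

lemma nested_cases: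
  assumes S: "separation_system S" and N: "nested S" and r: "r \<in> carr S" and s: "s \<in> carr S"
  obtains "(r, s) \<in> sle S" | "(s, r) \<in> sle S" | "(r, sinv S s) \<in> sle S" | "(sinv S s, r) \<in> sle S"
proof -
  obtain r' s' where "r' \<in> {r, sinv S r}" "s' \<in> {s, sinv S s}"
      "(r', s') \<in> sle S \<or> (s', r') \<in> sle S"
    using N r s unfolding nested_def unor_def by meson
  then show ?thesis
    using that separation_systemD(7,8)[OF S] r s by (elim insertE emptyE disjE) metis+
qed

lemma orientation_cases:
  assumes "orientation S Q" "x \<in> carr S"
  shows "x \<in> Q \<or> sinv S x \<in> Q"
  using assms unfolding orientation_def unor_def by fastforce

lemma orientation_sinv_notin:
  assumes "orientation S Q" "x \<in> Q" "sinv S x \<noteq> x"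
  shows "sinv S x \<notin> Q"
proof -
  have "x \<in> carr S" using assms by (auto simp: orientation_def)
  then have "\<exists>!y. y \<in> Q \<and> y \<in> {x, sinv S x}"
    using assms(1) by (simp add: orientation_def unor_def)
  then show ?thesis using assms by blast
qed

text \<open>The two conditions in \<open>neq\<close> guarantee that \<open>x\<close> and
  \<open>y\<close> orient different separations: the second one excludes
  \<open>x = sinv S y\<close>.\<close>

lemma consistentD:
  assumes S: "separation_system S" and Q: "Q \<subseteq> carr S" and C: "consistent S Q"
    and x: "x \<in> Q" and y: "y \<in> Q" and neq: "x \<noteq> y" "sinv S y \<notin> Q"
  shows "(sinv S x, y) \<notin> sle S"
proof
  assume le: "(sinv S x, y) \<in> sle S"
  note D = separation_systemD[OF S]
  have c: "x \<in> carr S" "y \<in> carr S" using Q x y by auto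
  have "sinv S x \<noteq> y" using neq x c D(7) by force
  moreover have "y \<notin> unor S (sinv S x)"
    using \<open>sinv S x \<noteq> y\<close> neq(1) c D(7) by (auto simp: unor_def)
  then have "unor S (sinv S x) \<noteq> unor S y" by (auto simp: unor_def)
  ultimately show False
    using C le c x y D(6,7) unfolding consistent_def sless_def by metis
qed

text \<open>A degenerate \<open>x\<close> is small, hence trivial with some witness
  \<open>y\<close>; inverting \<open>x \<le> sinv S y\<close> gives
  \<open>y \<le> sinv S x = x\<close>, against \<open>x < y\<close>.\<close>

lemma small_imp_trivial_not_degenerate:
  assumes S: "separation_system S"
    and triv: "\<And>s. s \<in> carr S \<Longrightarrow> small S s \<Longrightarrow> trivial S s" and x: "x \<in> carr S"
  shows "sinv S x \<noteq> x"
proof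
  note D = separation_systemD[OF S]
  assume deg: "sinv S x = x"
  then have "trivial S x" using triv x D(1) by (simp add: small_def)
  then obtain y where "(x, y) \<in> sle S" "(x, sinv S y) \<in> sle S" "x \<noteq> y" "y \<in> carr S"
    by (auto simp: trivial_def sless_def)
  then show False using deg D(3,7,8) by metis
qed

text \<open>If \<open>sinv S m\<close> were small, it would be trivial with some witness
  \<open>y\<close>. One orientation \<open>z\<close> of that witness lies in \<open>Q\<close> and
  above \<open>sinv S m\<close>, so \<open>m\<close> and \<open>z\<close> violate
  consistency.\<close>

lemma consistent_no_cosmall:
  assumes S: "separation_system S"
    and triv: "\<And>s. s \<in> carr S \<Longrightarrow> small S s \<Longrightarrow> trivial S s"
    and O: "orientation S Q" and C: "consistent S Q" and m: "m \<in> Q"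
  shows "(sinv S m, m) \<notin> sle S"
proof
  note D = separation_systemD[OF S]
  assume le: "(sinv S m, m) \<in> sle S"
  have Q: "Q \<subseteq> carr S" using O by (simp add: orientation_def)
  then have mc: "m \<in> carr S" using m by auto
  then have "trivial S (sinv S m)" using triv le D(6,7) by (simp add: small_def)
  then obtain y where y: "y \<in> carr S" "unor S y \<noteq> unor S (sinv S m)"
      "(sinv S m, y) \<in> sle S" "(sinv S m, sinv S y) \<in> sle S"
    by (auto simp: trivial_def sless_def)
  have "y \<noteq> m" "sinv S y \<noteq> m"
    using y(1,2) mc D(7) by (auto simp: unor_def)
  then have "\<exists>z\<in>Q. z \<noteq> m \<and> (sinv S m, z) \<in> sle S"
    using orientation_cases[OF O y(1)] y(3,4) by blast
  then obtain z where z: "z \<in> Q" "z \<noteq> m" "(sinv S m, z) \<in> sle S" by blast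
  have "sinv S z \<notin> Q"
    using orientation_sinv_notin[OF O z(1)] small_imp_trivial_not_degenerate[OF S triv] z(1) Q
    by blast
  with consistentD[OF S Q C m z(1)] z show False by simp
qed

section \<open>Separation systems with coordinates and a compact topology\<close>

text \<open>Collects what the argument needs of a profinite system, with \<open>c p\<close> as the
  projection to \<open>F p\<close>, so that the inverse limit and its isomorphic copies are treated
  at once.\<close>

locale compact_sepsys =
  fixes S :: "'b sepsys" and X :: "'b topology" and P :: "'i set" and F :: "'i \<Rightarrow> 'a sepsys"
    and c :: "'i \<Rightarrow> 'b \<Rightarrow> 'a"
  assumes sep: "separation_system S"
    and sep_coord: "p \<in> P \<Longrightarrow> separation_system (F p)"
    and le_iff: "x \<in> carr S \<Longrightarrow> y \<in> carr S \<Longrightarrow>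
      (x, y) \<in> sle S \<longleftrightarrow> (\<forall>p\<in>P. (c p x, c p y) \<in> sle (F p))"
    and coord_sinv: "p \<in> P \<Longrightarrow> x \<in> carr S \<Longrightarrow> c p (sinv S x) = sinv (F p) (c p x)"
    and topspace: "topspace X = carr S"
    and compact: "compact_space X"
    and closedin_cylinder: "p \<in> P \<Longrightarrow> closedin X {x \<in> carr S. c p x \<in> A}"
begin

lemmas sepD = separation_systemD[OF sep]

lemma openin_cylinder:
  assumes "p \<in> P"
  shows "openin X {x \<in> carr S. c p x \<in> A}"
proof -
  have "carr S - {x \<in> carr S. c p x \<in> - A} = {x \<in> carr S. c p x \<in> A}" by auto
  then show ?thesis
    using openin_diff[OF openin_topspace closedin_cylinder[OF assms, of "- A"]]
    by (simp add: topspace)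
qed

lemma closedin_cylinders:
  "closedin X {x \<in> carr S. \<forall>p\<in>P. c p x \<in> A p}"
proof -
  \<comment> \<open>The whole space is included to keep the family nonempty when \<open>P\<close> is
    empty.\<close>
  have "closedin X (\<Inter> (insert (topspace X) ((\<lambda>p. {x \<in> carr S. c p x \<in> A p}) ` P)))"
    by (rule closedin_Inter) (auto intro: closedin_cylinder)
  moreover have "\<Inter> (insert (topspace X) ((\<lambda>p. {x \<in> carr S. c p x \<in> A p}) ` P))
      = {x \<in> carr S. \<forall>p\<in>P. c p x \<in> A p}"
    by (auto simp: topspace)
  ultimately show ?thesis by simp
qed

text \<open>The order is tested coordinatewise, so a principal up-set is an intersection of
  cylinders.\<close>

lemma closedin_above: "closedin X {y. (x, y) \<in> sle S}"
proof (cases "x \<in> carr S")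
  case True
  then have "{y. (x, y) \<in> sle S} = {y \<in> carr S. \<forall>p\<in>P. c p y \<in> {z. (c p x, z) \<in> sle (F p)}}"
    using le_iff[OF True] sepD(5) by blast
  then show ?thesis using closedin_cylinders[of "\<lambda>p. {z. (c p x, z) \<in> sle (F p)}"] by simp
next
  case False
  then have "{y. (x, y) \<in> sle S} = {}" using sepD(4) by auto
  then show ?thesis by simp
qed

lemma closedin_below: "closedin X {y. (y, x) \<in> sle S}"
proof (cases "x \<in> carr S")
  case True
  then have "{y. (y, x) \<in> sle S} = {y \<in> carr S. \<forall>p\<in>P. c p y \<in> {z. (z, c p x) \<in> sle (F p)}}"
    using le_iff[OF _ True] sepD(4) by blast
  then show ?thesis using closedin_cylinders[of "\<lambda>p. {z. (z, c p x) \<in> sle (F p)}"] by simp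
next
  case False
  then have "{y. (y, x) \<in> sle S} = {}" using sepD(5) by auto
  then show ?thesis by simp
qed

section \<open>Maximal elements of closed sets\<close>

lemma finite_chain_has_greatest:
  assumes "finite B" "B \<noteq> {}" "\<forall>x\<in>B. \<forall>y\<in>B. (x, y) \<in> sle S \<or> (y, x) \<in> sle S"
  shows "\<exists>b\<in>B. \<forall>a\<in>B. (a, b) \<in> sle S"
  using assms
proof (induction B rule: finite_ne_induct)
  case (insert x B)
  then obtain b where b: "b \<in> B" "\<forall>a\<in>B. (a, b) \<in> sle S" by auto
  with insert.prems have "(x, b) \<in> sle S \<or> (b, x) \<in> sle S" "(x, x) \<in> sle S" by auto
  with b show ?case using sepD(2) by (metis insert_iff)
qed simp

text \<open>Zorn's lemma is applied to the part of \<open>Q\<close> above \<open>x\<close>; an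
  element maximal there is maximal in \<open>Q\<close>, as everything above it is also above
  \<open>x\<close>.\<close>

lemma closed_imp_below_maximal:
  assumes Q: "closedin X Q" and x: "x \<in> Q"
  shows "\<exists>m\<in>maximal_elements S Q. (x, m) \<in> sle S"
proof -
  let ?A = "{y \<in> Q. (x, y) \<in> sle S}"
  let ?le = "\<lambda>a b. (a, b) \<in> sle S"
  have Qc: "Q \<subseteq> carr S" using closedin_subset[OF Q] topspace by simp
  then have xA: "x \<in> ?A" using x sepD(1) by auto
  have "\<exists>m\<in>?A. \<forall>a\<in>?A. ?le m a \<longrightarrow> a = m"
  proof (rule predicate_Zorn)
    show "partial_order_on ?A (relation_of ?le ?A)"
      using Qc sepD(1,2,3) by (intro partial_order_on_relation_ofI) blast+
    fix C assume "C \<in> Chains (relation_of ?le ?A)"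
    then have C: "C \<subseteq> ?A" "\<forall>a\<in>C. \<forall>b\<in>C. ?le a b \<or> ?le b a"
      by (auto simp: Chains_def relation_of_def)
    \<comment> \<open>A point common to these sets bounds the chain within \<open>Q\<close>;
      including \<open>x\<close> puts it into \<open>?A\<close> even if the chain is empty.\<close>
    let ?U = "insert Q ((\<lambda>a. {y. ?le a y}) ` (insert x C))"
    have "\<Inter>?U \<noteq> {}"
    proof (rule compact[unfolded compact_space_fip, rule_format], intro conjI ballI allI impI)
      show "closedin X D" if "D \<in> ?U" for D using that Q closedin_above by blast
      fix G assume G: "finite G \<and> G \<subseteq> ?U"
      then have "finite (G - {Q})" "G - {Q} \<subseteq> (\<lambda>a. {y. ?le a y}) ` (insert x C)" by auto
      from finite_subset_image[OF this]
      obtain B where B: "B \<subseteq> insert x C" "finite B" "G - {Q} = (\<lambda>a. {y. ?le a y}) ` B"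
        by metis
      \<comment> \<open>The greatest of \<open>x\<close> and the finitely many chain elements
        indexing \<open>G\<close> lies in every member of \<open>G\<close>.\<close>
      have "\<exists>b\<in>insert x B. \<forall>a\<in>insert x B. ?le a b"
      proof (rule finite_chain_has_greatest)
        show "\<forall>a\<in>insert x B. \<forall>b\<in>insert x B. ?le a b \<or> ?le b a"
          using B(1) C xA by blast
      qed (use B in auto)
      then obtain b where b: "b \<in> insert x B" "\<forall>a\<in>insert x B. ?le a b" by blast
      have "b \<in> Q" using b(1) B(1) C(1) x by blast
      have "b \<in> D" if "D \<in> G" for D
      proof (cases "D = Q")
        case False
        with that have "D \<in> G - {Q}" by simp
        then obtain a where "a \<in> B" "D = {y. ?le a y}" unfolding B(3) by (rule imageE)
        then show ?thesis using b(2) by simp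
      qed (simp add: \<open>b \<in> Q\<close>)
      then show "\<Inter>G \<noteq> {}" by blast
    qed
    then show "\<exists>u\<in>?A. \<forall>a\<in>C. ?le a u" by auto
  qed
  then obtain m where m: "m \<in> ?A" "\<forall>a\<in>?A. ?le m a \<longrightarrow> a = m" by blast
  have "\<not> sless S m a" if "a \<in> Q" for a
    using m that sepD(2)[of x m a] by (auto simp: sless_def)
  then show ?thesis using m(1) by (auto simp: maximal_elements_def)
qed

lemma closed_imp_splits:
  assumes "closedin X Q"
  shows "splits S Q"
  using closed_imp_below_maximal[OF assms] closedin_subset[OF assms] topspace
  by (auto simp: splits_def down_closure_def)

section \<open>Split consistent orientations are closed\<close>

context
  fixes Q
  assumes nested: "nested S"
    and triv: "\<And>s. s \<in> carr S \<Longrightarrow> small S s \<Longrightarrow> trivial S s"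
    and ori: "orientation S Q" and cons: "consistent S Q" and split: "splits S Q"
begin

lemma Q_subset: "Q \<subseteq> carr S"
  using ori by (simp add: orientation_def)

lemma sinv_notin: "x \<in> Q \<Longrightarrow> sinv S x \<notin> Q"
  using orientation_sinv_notin[OF ori] small_imp_trivial_not_degenerate[OF sep triv] Q_subset
  by blast

text \<open>Of the four nested cases, \<open>m \<le> r\<close> contradicts maximality and
  \<open>sinv S m \<le> r\<close> contradicts consistency.\<close>

lemma below_maximal_or_sinv:
  assumes m: "m \<in> maximal_elements S Q" and r: "r \<in> Q" and neq: "r \<noteq> m"
  shows "(r, m) \<in> sle S \<or> (r, sinv S m) \<in> sle S"
proof -
  have mQ: "m \<in> Q" using m by (simp add: maximal_elements_def)
  have "(m, r) \<notin> sle S"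
    using m r neq by (auto simp: maximal_elements_def sless_def)
  moreover have "(sinv S m, r) \<notin> sle S"
    using consistentD[OF sep Q_subset cons mQ r] neq sinv_notin[OF r] by auto
  moreover have "r \<in> carr S" "m \<in> carr S" using r mQ Q_subset by auto
  ultimately show ?thesis by (meson nested_cases[OF sep nested])
qed

lemma obtain_maximal:
  assumes "x \<in> Q"
  obtains m where "m \<in> maximal_elements S Q" "m \<in> Q" "(x, m) \<in> sle S"
  using assms split by (auto simp: splits_def down_closure_def maximal_elements_def)

lemma limit_eq_sinv_maximal:
  assumes s: "s \<in> X closure_of Q" "s \<notin> Q"
  obtains m where "m \<in> maximal_elements S Q" "m \<in> Q" "s = sinv S m"
proof -
  have sc: "s \<in> carr S" using s(1) topspace closure_of_subset_topspace by fastforce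
  then have "sinv S s \<in> Q" using orientation_cases[OF ori] s(2) by blast
  then obtain m where m: "m \<in> maximal_elements S Q" "m \<in> Q" "(sinv S s, m) \<in> sle S"
    by (rule obtain_maximal)
  have le: "(sinv S m, s) \<in> sle S" using sepD(7,8) m(3) sc by metis
  \<comment> \<open>Both down-sets are closed, so their union also contains the limit point
    \<open>s\<close>.\<close>
  have "Q \<subseteq> {r. (r, m) \<in> sle S} \<union> {r. (r, sinv S m) \<in> sle S}"
    using below_maximal_or_sinv[OF m(1)] sepD(1) Q_subset by auto
  then have "X closure_of Q \<subseteq> {r. (r, m) \<in> sle S} \<union> {r. (r, sinv S m) \<in> sle S}"
    by (rule closure_of_minimal) (intro closedin_Un closedin_below)
  with s(1) consider "(s, m) \<in> sle S" | "(s, sinv S m) \<in> sle S" by blast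
  then show ?thesis
  proof cases
    case 1
    then have "(sinv S m, m) \<in> sle S" using le sepD(2) by blast
    then show ?thesis using consistent_no_cosmall[OF sep triv ori cons m(2)] by blast
  next
    case 2
    then show ?thesis using that m le sepD(3) by blast
  qed
qed

lemma projection_small:
  assumes m: "m \<in> maximal_elements S Q" "m \<in> Q" and lim: "sinv S m \<in> X closure_of Q"
    and p: "p \<in> P"
  shows "(c p (sinv S m), c p m) \<in> sle (F p)"
proof (rule ccontr)
  assume no: "(c p (sinv S m), c p m) \<notin> sle (F p)"
  note Dp = separation_systemD[OF sep_coord[OF p]]
  have mc: "m \<in> carr S" "sinv S m \<in> carr S" using m(2) Q_subset sepD(6) by auto
  have lep: "(c p x, c p y) \<in> sle (F p)" if "(x, y) \<in> sle S" for x y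
    using that le_iff sepD(4,5) p by blast
  \<comment> \<open>Every neighbourhood of \<open>sinv S m\<close> meets \<open>Q\<close> in some
    \<open>r\<close> below a maximal \<open>a\<close> that lies below \<open>sinv S m\<close> and
    has the same coordinate at \<open>p\<close>.\<close>
  have near: "\<exists>r a. r \<in> U \<and> (r, a) \<in> sle S \<and> a \<in> maximal_elements S Q \<and> a \<in> Q \<and>
      (a, sinv S m) \<in> sle S \<and> c p a = c p (sinv S m)"
    if U: "openin X U" "sinv S m \<in> U" for U
  proof -
    \<comment> \<open>Cutting \<open>U\<close> down to an open cylinder fixes the coordinate of
      \<open>r\<close> at \<open>p\<close>.\<close>
    let ?V = "U \<inter> {x \<in> carr S. c p x \<in> {c p (sinv S m)}}"
    have "openin X ?V" "sinv S m \<in> ?V"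
      using openin_cylinder[OF p, of "{c p (sinv S m)}"] U mc by auto
    then obtain r where r: "r \<in> Q" "r \<in> ?V"
      using lim[unfolded in_closure_of, THEN conjunct2, rule_format, of ?V] by metis
    obtain a where a: "a \<in> maximal_elements S Q" "a \<in> Q" "(r, a) \<in> sle S"
      using obtain_maximal[OF r(1)] by blast
    \<comment> \<open>Otherwise \<open>r \<le> m\<close> would project to the comparison excluded by
      \<open>no\<close>.\<close>
    have "a \<noteq> m" using no lep[OF a(3)] r(2) by auto
    moreover from this have "(a, m) \<notin> sle S"
      using a(1) m(2) by (auto simp: maximal_elements_def sless_def)
    ultimately have le: "(a, sinv S m) \<in> sle S"
      using below_maximal_or_sinv[OF m(1) a(2)] by blast
    \<comment> \<open>From \<open>r \<le> a \<le> sinv S m\<close>, with equal outer coordinates at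
      \<open>p\<close>, antisymmetry in \<open>F p\<close> applies.\<close>
    have "c p a = c p (sinv S m)" using lep[OF a(3)] lep[OF le] r(2) Dp(3) by simp
    with a le r show ?thesis by blast
  qed
  obtain a where a: "a \<in> maximal_elements S Q" "a \<in> Q" "(a, sinv S m) \<in> sle S"
      "c p a = c p (sinv S m)"
    using near[OF openin_topspace] mc topspace by auto
  have "(sinv S m, a) \<notin> sle S"
    using a sinv_notin[OF m(2)] sepD(3) by blast
  \<comment> \<open>The complement of the down-set of \<open>a\<close> is an open neighbourhood of
    \<open>sinv S m\<close>. Applying \<open>near\<close> to it yields \<open>r\<close> below
    \<open>b\<close> but not below \<open>a\<close>, so a second maximal element.\<close>
  then obtain r b where b: "(r, a) \<notin> sle S" "(r, b) \<in> sle S" "b \<in> maximal_elements S Q"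
      "b \<in> Q" "c p b = c p (sinv S m)"
    using near[OF openin_diff[OF openin_topspace closedin_below[of a]]] mc topspace by auto
  have "b \<noteq> a" using b by blast
  moreover from this have "(b, a) \<notin> sle S"
    using a(2) b(3) by (auto simp: maximal_elements_def sless_def)
  ultimately have "(b, sinv S a) \<in> sle S"
    using below_maximal_or_sinv[OF a(1) b(4)] by blast
  \<comment> \<open>With this, \<open>b \<le> sinv S a\<close> projects to exactly the comparison
    excluded by \<open>no\<close>.\<close>
  moreover have "c p (sinv S a) = c p m"
  proof -
    have "c p (sinv S a) = c p (sinv S (sinv S m))"
      using a(2,4) mc Q_subset coord_sinv[OF p] by auto
    then show ?thesis using mc sepD(7) by simp
  qed
  ultimately show False using lep b(5) no by fastforce
qed

lemma splits_imp_closed: "closedin X Q"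
proof -
  have "s \<in> Q" if s: "s \<in> X closure_of Q" for s
  proof (rule ccontr)
    assume "s \<notin> Q"
    then obtain m where m: "m \<in> maximal_elements S Q" "m \<in> Q" "s = sinv S m"
      using limit_eq_sinv_maximal s by blast
    \<comment> \<open>The projections are small at every \<open>p\<close>, and the order is
      determined by the coordinates.\<close>
    then have "(sinv S m, m) \<in> sle S"
      using projection_small[OF m(1,2)] s le_iff Q_subset sepD(6) by blast
    then show False using consistent_no_cosmall[OF sep triv ori cons m(2)] by blast
  qed
  then show ?thesis
    by (metis closure_of_subset_eq subsetI topspace Q_subset)
qed

end

lemma normalI:
  assumes "nested S" "\<And>s. s \<in> carr S \<Longrightarrow> small S s \<Longrightarrow> trivial S s"
  shows "normal S X"
  using assms splits_imp_closed closed_imp_splits unfolding normal_def by blast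

end

section \<open>Compactness of inverse limits and transfer to profinite systems\<close>

lemma mem_inverse_limit:
  "x \<in> carr (inverse_limit P R F f) \<longleftrightarrow> x \<in> (\<Pi>\<^sub>E p\<in>P. carr (F p)) \<and>
     (\<forall>p q. (p, q) \<in> R \<and> p \<noteq> q \<longrightarrow> f q p (x q) = x p)"
  by (simp add: inverse_limit_def Let_def)

lemma topspace_inverse_limit_topology:
  "topspace (inverse_limit_topology P R F f) = carr (inverse_limit P R F f)"
  by (auto simp: inverse_limit_topology_def mem_inverse_limit)

lemma inverse_systemD:
  assumes "inverse_system P R F f"
  shows "p \<in> P \<Longrightarrow> separation_system (F p)"
    and "(p, q) \<in> R \<Longrightarrow> p \<in> P" and "(p, q) \<in> R \<Longrightarrow> q \<in> P"
    and "(p, q) \<in> R \<Longrightarrow> p \<noteq> q \<Longrightarrow> x \<in> carr (F q) \<Longrightarrow> f q p x \<in> carr (F p)"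
proof -
  show "p \<in> P \<Longrightarrow> separation_system (F p)"
    using assms by (simp add: inverse_system_def)
  show "(p, q) \<in> R \<Longrightarrow> p \<in> P" "(p, q) \<in> R \<Longrightarrow> q \<in> P"
    using assms by (auto simp: inverse_system_def directed_poset_def dest: partial_order_onD(4))
  show "(p, q) \<in> R \<Longrightarrow> p \<noteq> q \<Longrightarrow> x \<in> carr (F q) \<Longrightarrow> f q p x \<in> carr (F p)"
    using assms unfolding inverse_system_def sep_hom_def by blast
qed

text \<open>By Tychonoff the product is compact. Each compatibility condition equates two continuous
  maps into a discrete, hence Hausdorff, space, so the limit is closed in the product.\<close>

lemma compact_space_inverse_limit:
  assumes sys: "inverse_system P R F f" and fin: "\<forall>p\<in>P. finite (carr (F p))"
  shows "compact_space (inverse_limit_topology P R F f)"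
proof -
  let ?T = "product_topology (\<lambda>p. discrete_topology (carr (F p))) P"
  let ?E = "\<Pi>\<^sub>E p\<in>P. carr (F p)"
  note D = inverse_systemD[OF sys]
  have "closedin ?T {x \<in> topspace ?T. f q p (x q) = x p}" if "(p, q) \<in> R" "p \<noteq> q" for p q
  proof (rule closedin_continuous_maps_eq)
    show "Hausdorff_space (discrete_topology (carr (F p)))" by simp
    have "continuous_map (discrete_topology (carr (F q))) (discrete_topology (carr (F p))) (f q p)"
      using D(4) that by simp
    then show "continuous_map ?T (discrete_topology (carr (F p))) (\<lambda>x. f q p (x q))"
      by (rule continuous_map_compose[unfolded o_def,
            OF continuous_map_product_projection[OF D(3)[OF that(1)]]])
    show "continuous_map ?T (discrete_topology (carr (F p))) (\<lambda>x. x p)"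
      using continuous_map_product_projection[OF D(2)[OF that(1)]] by blast
  qed
  then have "closedin ?T (\<Inter>(insert (topspace ?T)
      ((\<lambda>(p, q). {x \<in> topspace ?T. f q p (x q) = x p}) ` {(p, q) \<in> R. p \<noteq> q})))"
    by (intro closedin_Inter) (auto simp del: topspace_product_topology)
  moreover have "\<Inter>(insert (topspace ?T)
      ((\<lambda>(p, q). {x \<in> topspace ?T. f q p (x q) = x p}) ` {(p, q) \<in> R. p \<noteq> q}))
      = carr (inverse_limit P R F f)"
    by (auto simp: mem_inverse_limit)
  ultimately have "closedin ?T (carr (inverse_limit P R F f))" by simp
  moreover have "compact_space ?T"
    using fin by (auto simp: compact_space_product_topology compact_space_discrete_topology)
  ultimately show ?thesis
    unfolding inverse_limit_topology_def
    by (metis closedin_compact_space compact_space_subtopology)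
qed

lemma continuous_map_inverse_limit_coordinate:
  assumes "p \<in> P"
  shows "continuous_map (inverse_limit_topology P R F f) (discrete_topology (carr (F p))) (\<lambda>x. x p)"
  unfolding inverse_limit_topology_def
  using continuous_map_product_projection[OF assms] by (rule continuous_map_from_subtopology)

lemma compact_sepsys_profinite:
  assumes prof: "profinite_via T X P R F f h"
  shows "compact_sepsys T X P F (\<lambda>p x. h x p)"
proof -
  let ?L = "inverse_limit P R F f" and ?Y = "inverse_limit_topology P R F f"
  let ?g = "inv_into (carr T) h"
  have sys: "inverse_system P R F f" and fin: "\<forall>p\<in>P. finite (carr (F p))"
    and sepT: "separation_system T" and bij: "bij_betw h (carr T) (carr ?L)"
    and hom: "sep_hom T ?L h" and hom': "sep_hom ?L T ?g"
    and X: "X = pullback_topology (carr T) h ?Y"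
    using prof by (auto simp: profinite_via_def sep_iso_def)
  have hc: "h x \<in> carr ?L" if "x \<in> carr T" for x using bij that by (auto simp: bij_betw_def)
  have le: "(u, v) \<in> sle ?L \<longleftrightarrow> u \<in> carr ?L \<and> v \<in> carr ?L \<and> (\<forall>p\<in>P. (u p, v p) \<in> sle (F p))" for u v
    by (simp add: inverse_limit_def Let_def)
  have topX: "topspace X = carr T"
    using hc by (auto simp: X topspace_pullback_topology topspace_inverse_limit_topology)
  show ?thesis
  proof
    show "separation_system T" by (rule sepT)
    show "topspace X = carr T" by (rule topX)
    show "separation_system (F p)" if "p \<in> P" for p using inverse_systemD(1)[OF sys that] .
    show "(x, y) \<in> sle T \<longleftrightarrow> (\<forall>p\<in>P. (h x p, h y p) \<in> sle (F p))"
      if xy: "x \<in> carr T" "y \<in> carr T" for x y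
    proof -
      have "?g (h x) = x" "?g (h y) = y" using bij xy by (auto simp: bij_betw_def)
      then have "(x, y) \<in> sle T \<longleftrightarrow> (h x, h y) \<in> sle ?L"
        using hom hom' unfolding sep_hom_def by metis
      then show ?thesis using le hc xy by blast
    qed
    show "h (sinv T x) p = sinv (F p) (h x p)" if "p \<in> P" "x \<in> carr T" for p x
      using hom that by (simp add: sep_hom_def inverse_limit_def Let_def)
    show "compact_space X"
    proof -
      \<comment> \<open>Continuity into a pullback is tested after composing with \<open>h\<close>,
        and \<open>h \<circ> ?g\<close> is the identity on the limit. So \<open>X\<close> is a
        continuous image of a compact space.\<close>
      have "continuous_map ?Y X ?g"
        unfolding X
      proof (rule continuous_map_pullback')
        show "topspace ?Y \<subseteq> ?g -` carr T"
          using bij by (auto simp: topspace_inverse_limit_topology bij_betw_def inv_into_into)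
        show "continuous_map ?Y ?Y (h \<circ> ?g)"
        proof (rule continuous_map_eq[OF continuous_map_id])
          show "id u = (h \<circ> ?g) u" if "u \<in> topspace ?Y" for u
            using bij that by (auto simp: topspace_inverse_limit_topology bij_betw_def f_inv_into_f)
        qed
      qed
      then have "compactin X (?g ` topspace ?Y)"
        using compact_space_inverse_limit[OF sys fin] image_compactin
        unfolding compact_space_def by blast
      moreover have "?g ` topspace ?Y = topspace X"
        using bij by (simp add: topX topspace_inverse_limit_topology bij_betw_imp_surj_on
            bij_betw_inv_into)
      ultimately show ?thesis by (simp add: compact_space_def)
    qed
    show "closedin X {x \<in> carr T. h x p \<in> A}" if "p \<in> P" for p A
    proof -
      have "continuous_map X (discrete_topology (carr (F p))) ((\<lambda>u. u p) \<circ> h)"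
        unfolding X by (rule continuous_map_pullback[OF continuous_map_inverse_limit_coordinate[OF that]])
      \<comment> \<open>Closed sets of the discrete space lie in \<open>carr (F p)\<close>, hence
        the intersection; all coordinates at \<open>p\<close> lie there anyway.\<close>
      then have "closedin X {x \<in> topspace X. h x p \<in> A \<inter> carr (F p)}"
        using closedin_continuous_map_preimage[of X _ _ "A \<inter> carr (F p)"] by fastforce
      moreover have "{x \<in> topspace X. h x p \<in> A \<inter> carr (F p)} = {x \<in> carr T. h x p \<in> A}"
        using hc that by (auto simp: topX mem_inverse_limit)
      ultimately show ?thesis by simp
    qed
  qed
qed

text \<open>Makes the limit itself an instance of \<open>compact_sepsys_profinite\<close>, with the
  identity as isomorphism.\<close>

lemma profinite_via_inverse_limit:
  assumes sys: "inverse_system P R F f" and fin: "\<forall>p\<in>P. finite (carr (F p))"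
  shows "profinite_via (inverse_limit P R F f) (inverse_limit_topology P R F f) P R F f id"
proof -
  let ?L = "inverse_limit P R F f" and ?Y = "inverse_limit_topology P R F f"
  have sep: "separation_system ?L" by (rule separation_system_inverse_limit[OF sys])
  have "sep_hom ?L ?L id" by (auto simp: sep_hom_def)
  moreover have "inv_into (carr ?L) id x = x" if "x \<in> carr ?L" for x
    using that by (simp add: inv_into_f_eq)
  then have "sep_hom ?L ?L (inv_into (carr ?L) id)"
    using separation_systemD(4,5,6)[OF sep] by (auto simp: sep_hom_def)
  ultimately have "sep_iso ?L ?L id" by (simp add: sep_iso_def)
  moreover have "?Y = pullback_topology (carr ?L) id ?Y"
  proof (rule topology_eq[THEN iffD2], intro allI)
    fix U
    show "openin ?Y U \<longleftrightarrow> openin (pullback_topology (carr ?L) id ?Y) U"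
      using openin_subset[of ?Y] topspace_inverse_limit_topology[of P R F f]
      by (auto simp: openin_pullback_topology) (metis Int_absorb2)+
  qed
  ultimately show ?thesis using sys fin sep by (simp add: profinite_via_def)
qed

theorem theorem7p4:
  fixes P :: "'i set" and R :: "'i rel" and F :: "'i \<Rightarrow> 'a sepsys"
    and f :: "'i \<Rightarrow> 'i \<Rightarrow> 'a \<Rightarrow> 'a"
  assumes "inverse_system P R F f"
    and "\<forall>p\<in>P. finite (carr (F p))"
  shows "(nested (inverse_limit P R F f) \<and>
          (\<forall>s\<in>carr (inverse_limit P R F f).
             small (inverse_limit P R F f) s \<longrightarrow> trivial (inverse_limit P R F f) s)
          \<longrightarrow> normal (inverse_limit P R F f) (inverse_limit_topology P R F f))
       \<and> (\<forall>(T :: 'b sepsys) X h.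
            profinite_via T X P R F f h \<and> tree_set T \<and> regular T \<longrightarrow> normal T X)"
proof (intro conjI allI impI)
  show "normal (inverse_limit P R F f) (inverse_limit_topology P R F f)"
    if "nested (inverse_limit P R F f) \<and>
          (\<forall>s\<in>carr (inverse_limit P R F f).
             small (inverse_limit P R F f) s \<longrightarrow> trivial (inverse_limit P R F f) s)"
    using compact_sepsys.normalI[OF compact_sepsys_profinite[OF profinite_via_inverse_limit]]
      assms that by blast
  \<comment> \<open>Regularity makes the condition on small separations vacuous.\<close>
  show "normal T X" if "profinite_via T X P R F f h \<and> tree_set T \<and> regular T"
    for T :: "'b sepsys" and X h
    using compact_sepsys.normalI[OF compact_sepsys_profinite[of T X P R F f h]] that
    by (auto simp: tree_set_def regular_def)
qed

end
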